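(* Let $e\ge 3$ be an integer and $n=(3^{e-1}+3^{e-2}-1)(1+3^e+3^{2e})+2+3^{e-2}+3^{2e-2}$. Then $g_{n,3}$ is a permutation polynomial of $\mathbb{F}_{3^e}$.
   Context: For a prime $p$, a power $q$ of $p$ and an integer $n\ge 0$, $g_{n,q}\in\mathbb{F}_p[x]$ is the unique polynomial with $\sum_{a\in\mathbb{F}_q}(x+a)^n=g_{n,q}(x^q-x)$. A permutation polynomial of a finite field $\mathbb{F}$ is a polynomial inducing a bijection of $\mathbb{F}$. *)

theory Defs
  imports "Berlekamp_Zassenhaus.Finite_Field" "HOL-Computational_Algebra.Polynomial"
begin

text \<open>
  The prime field with p elements is modelled by the type \<open>'p mod_ring\<close>, where \<open>CARD('p) = p\<close>.
  Any other finite field is a type of class \<open>{field, finite}\<close>; when it has characteristic p, the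
  following map is the unique homomorphism from the prime field into it. In any other
  characteristic the map is not a homomorphism.
\<close>

definition prime_field_embed :: "'p::prime_card mod_ring \<Rightarrow> 'a::field" where
  "prime_field_embed c = of_int (to_int_mod_ring c)"

text \<open>
  The field with q elements is passed as a type \<open>'q\<close>. The defining identity is one between
  polynomials over \<open>'q\<close>. It determines a unique polynomial over the prime field whenever
  \<open>CARD('q)\<close> is a power of \<open>CARD('p)\<close>, and the definition is only meant to be used in that case.
\<close>

definition g_poly :: "'q::{field,finite} itself \<Rightarrow> nat \<Rightarrow> 'p::prime_card mod_ring poly" where
  "g_poly _ n = (THE g :: 'p mod_ring poly.
     (\<Sum>a\<in>(UNIV :: 'q set). [:a, 1:] ^ n) =
     map_poly prime_field_embed g \<circ>\<^sub>p (monom 1 CARD('q) - monom 1 1))"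

definition permutation_poly :: "'a::{field,finite} poly \<Rightarrow> bool" where
  "permutation_poly f \<longleftrightarrow> bij (poly f)"

end

theory Submission
  imports "HOL-Algebra.Algebraic_Closure_Type" Defs
begin

text \<open>
  Write \<open>Q = 3 ^ e\<close> and \<open>y = x ^ 3 - x\<close> with \<open>y\<close> in the field with \<open>Q\<close> elements and \<open>x\<close> in its
  algebraic closure. Then \<open>x ^ Q = x + t\<close>, where \<open>t\<close> is the absolute trace of \<open>y\<close>, and the base-3
  digits of \<open>n\<close> turn the power sum \<open>x ^ n + (x + 1) ^ n + (x - 1) ^ n\<close> into a closed expression in
  \<open>v = y ^ 3 ^ (e - 2)\<close>: it equals \<open>- v\<close> if \<open>t = 0\<close>, and \<open>- v - (s ^ 3 - s)\<close> with
  \<open>s = 1 / v\<close> otherwise. Elements of the form \<open>s ^ 3 - s\<close> have trace zero, so \<open>g\<close> changes the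
  sign of the trace. If two distinct \<open>v\<close> have the same value \<open>v + (s ^ 3 - s)\<close>, then \<open>v\<close> itself is
  of the form \<open>r ^ 3 - r\<close>, which excludes a nonzero trace; hence \<open>g\<close> is injective.
\<close>

section \<open>Fields of characteristic three\<close>

lemma CHAR_eq_of_CARD_power:
  assumes "CARD('a::{field,finite}) = p ^ e" "prime p"
  shows "CHAR('a) = p"
proof -
  have "prime CHAR('a)"
    using prime_CHAR_semidom[where ?'a = 'a] finite_imp_CHAR_pos[where ?'a = 'a] by simp
  moreover have "CHAR('a) dvd p ^ e"
    using CHAR_dvd_CARD[where ?'a = 'a] assms(1) by simp
  ultimately show ?thesis
    using assms(2) by (metis prime_dvd_power primes_dvd_imp_eq)
qed

lemma finite_field_power_CARD:
  fixes x :: "'a::{field,finite}"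
  shows "x ^ CARD('a) = x"
proof (cases "x = 0")
  case True
  thus ?thesis by (simp add: zero_less_card_finite)
next
  case False
  let ?P = "\<Prod>y\<in>UNIV - {0::'a}. y"
  have "bij_betw ((*) x) (UNIV - {0}) (UNIV - {0})"
    by (rule bij_betw_byWitness[of _ "\<lambda>y. y / x"]) (use False in auto)
  hence "?P = (\<Prod>y\<in>UNIV - {0}. x * y)"
    by (rule prod.reindex_bij_betw[symmetric])
  also have "\<dots> = x ^ (CARD('a) - 1) * ?P"
    by (simp add: prod.distrib card_Diff_singleton)
  finally have "x ^ (CARD('a) - 1) = 1" by simp
  thus ?thesis by (simp add: power_eq_if[of x "CARD('a)"])
qed

lemma CHAR3_three_eq_0:
  assumes "CHAR('k::field) = 3"
  shows "(3 :: 'k) = 0"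
  using of_nat_CHAR[where ?'a = 'k] assms by simp

lemma CHAR3_frobenius_add:
  assumes "CHAR('k::field) = 3"
  shows "((x::'k) + y) ^ (3 ^ k) = x ^ (3 ^ k) + y ^ (3 ^ k)"
  using freshmans_dream'[where ?'a = 'k] assms by simp

lemma CHAR3_frobenius_diff:
  assumes "CHAR('k::field) = 3"
  shows "((x::'k) - y) ^ (3 ^ k) = x ^ (3 ^ k) - y ^ (3 ^ k)"
  using CHAR3_frobenius_add[OF assms, of "x - y" y k] by (simp add: eq_diff_eq)

lemma UNIV_of_CARD_3:
  assumes "CARD('q::{field,finite}) = 3"
  shows "(UNIV :: 'q set) = {0, 1, -1}" "(-1::'q) \<noteq> 1"
proof -
  have "CHAR('q) = 3"
    using CHAR_eq_of_CARD_power[where ?'a = 'q and p = 3 and e = 1] assms by simp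
  hence "(3::'q) = 0" by (rule CHAR3_three_eq_0)
  moreover have "(3::'q) = 1 + (1 + 1)" by simp
  ultimately show neq: "(-1::'q) \<noteq> 1"
    by (metis add.right_inverse add.right_neutral one_neq_zero)
  have "{0, 1, -1} = (UNIV :: 'q set)"
    by (rule card_subset_eq) (use assms neq in auto)
  thus "(UNIV :: 'q set) = {0, 1, -1}" by simp
qed

lemma CHAR3_cube_eq_self:
  fixes t :: "'k::idom"
  assumes "t ^ 3 = t"
  shows "t = 0 \<or> t = 1 \<or> t = -1"
proof -
  have "t * ((t - 1) * (t + 1)) = 0"
    using assms by (simp add: algebra_simps power3_eq_cube)
  thus ?thesis by (auto simp: eq_neg_iff_add_eq_0)
qed

section \<open>The polynomial \<open>g\<close> over the prime field\<close>

text \<open>Sums and products of representatives agree with those in the prime field up to reduction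
  mod \<open>CARD('p)\<close>, which \<open>of_int\<close> does not see in this
  characteristic.\<close>

lemma inj_idom_hom_prime_field_embed:
  assumes "CHAR('k::field) = CARD('p::prime_card)"
  shows "inj_idom_hom (prime_field_embed :: 'p mod_ring \<Rightarrow> 'k)"
proof -
  let ?h = "prime_field_embed :: 'p mod_ring \<Rightarrow> 'k"
  have m: "of_int (k mod int CARD('p)) = (of_int k :: 'k)" for k
    using of_int_mod_CHAR[where ?'a = 'k, of k] assms by simp
  interpret comm_ring_hom ?h
  proof
    show "?h 0 = 0" "?h 1 = 1" by (simp_all add: prime_field_embed_def)
    show "?h (x + y) = ?h x + ?h y" for x y
      by (simp add: prime_field_embed_def to_int_mod_ring_add m)
    show "?h (x * y) = ?h x * ?h y" for x y
      by (simp add: prime_field_embed_def to_int_mod_ring_mult m)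
  qed
  have "x = 0" if "?h x = 0" for x
  proof (rule ccontr)
    assume "x \<noteq> 0"
    hence "?h x * ?h (inverse x) = 1"
      by (simp flip: hom_mult)
    thus False using that by simp
  qed
  thus ?thesis by unfold_locales auto
qed

abbreviation "x3_minus_x \<equiv> (monom 1 3 - monom 1 1 :: 'k::field poly)"

text \<open>For \<open>c\<close> in the prime field, \<open>c ^ 3 = c\<close>, so
  \<open>Z = X + c\<close> satisfies \<open>Z ^ 3 = Z + (X ^ 3 - X)\<close>. The power sums
  therefore obey one linear recurrence whose coefficients are polynomials in
  \<open>X ^ 3 - X\<close>, with constant initial values 0, 0, 2.\<close>

lemma CHAR3_power_sum_eq_pcompose:
  assumes "CHAR('k::field) = 3"
  shows "\<exists>g :: 'k poly. [:0, 1:] ^ n + [:1, 1:] ^ n + [:-1, 1:] ^ n = g \<circ>\<^sub>p x3_minus_x"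
    (is "\<exists>g. ?S n = _")
proof (induction n rule: less_induct)
  case (less n)
  have three: "(3::'k) = 0" by (rule CHAR3_three_eq_0[OF assms])
  hence two: "(2::'k) = -1" by (simp add: eq_neg_iff_add_eq_0)
  consider "n = 0" | "n = 1" | "n = 2" | m where "n = m + 3"
    by (metis One_nat_def Suc_1 add.commute eval_nat_numeral(3) le_add_diff_inverse less_Suc_eq
        less_one linorder_not_less)
  thus ?case
  proof cases
    case 1
    thus ?thesis using three by (intro exI[of _ 0]) (simp add: one_pCons)
  next
    case 2
    thus ?thesis using three by (intro exI[of _ 0]) simp
  next
    case 3
    thus ?thesis using three by (intro exI[of _ "[:2:]"]) (simp add: power2_eq_square)
  next
    case (4 m)
    obtain g h where g: "?S m = g \<circ>\<^sub>p x3_minus_x" and h: "?S (m + 1) = h \<circ>\<^sub>p x3_minus_x"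
      using less[of m] less[of "m + 1"] 4 by auto
    have cube: "[:c, 1:] ^ 3 = [:c, 1:] + (x3_minus_x :: 'k poly)" if "c ^ 3 = c" for c :: 'k
      using that three by (simp add: power3_eq_cube monom_altdef algebra_simps)
    have step: "[:c, 1:] ^ (m + 3) = [:c, 1:] ^ (m + 1) + x3_minus_x * [:c, 1:] ^ m"
      if "c ^ 3 = c" for c :: 'k
      by (simp only: power_add cube[OF that]) (simp add: algebra_simps)
    have "?S n = ?S (m + 1) + x3_minus_x * ?S m"
      unfolding 4 by (subst (1 2 3) step) (simp_all add: algebra_simps)
    also have "\<dots> = (h + [:0, 1:] * g) \<circ>\<^sub>p x3_minus_x"
      unfolding g h pcompose_add pcompose_mult by (simp add: pcompose_pCons)
    finally show ?thesis ..
  qed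
qed

lemma degree_x3_minus_x: "degree (x3_minus_x :: 'k::field poly) = 3"
  using degree_add_eq_left[of "- monom (1::'k) 1" "monom 1 3"] by (simp add: degree_monom_eq)

text \<open>A witness found over the prime field can be mapped both to \<open>'q\<close>, where it
  meets the defining identity, and to \<open>'k\<close>, where it is evaluated. It is the only one
  because composition with a nonconstant polynomial is injective.\<close>

lemma poly_g_poly:
  assumes p: "CARD('p::prime_card) = 3" and q: "CARD('q::{field,finite}) = 3"
    and k: "CHAR('k::field) = 3"
  shows "poly (map_poly prime_field_embed (g_poly TYPE('q) n :: 'p mod_ring poly)) (x ^ 3 - x :: 'k)
    = x ^ n + (x + 1) ^ n + (x - 1) ^ n"
proof -
  have "CHAR('q) = 3"
    using CHAR_eq_of_CARD_power[where ?'a = 'q and p = 3 and e = 1] q by simp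
  then interpret hq: inj_idom_hom "prime_field_embed :: 'p mod_ring \<Rightarrow> 'q"
    using inj_idom_hom_prime_field_embed p by metis
  interpret hk: inj_idom_hom "prime_field_embed :: 'p mod_ring \<Rightarrow> 'k"
    using inj_idom_hom_prime_field_embed p k by metis
  interpret mq: map_poly_inj_idom_hom "prime_field_embed :: 'p mod_ring \<Rightarrow> 'q" ..
  interpret mk: map_poly_inj_idom_hom "prime_field_embed :: 'p mod_ring \<Rightarrow> 'k" ..
  have "CHAR('p mod_ring) = 3" using p by simp
  then obtain g :: "'p mod_ring poly" where
    g: "[:0, 1:] ^ n + [:1, 1:] ^ n + [:-1, 1:] ^ n = g \<circ>\<^sub>p x3_minus_x"
    using CHAR3_power_sum_eq_pcompose by blast
  have sum: "(\<Sum>a\<in>(UNIV :: 'q set). [:a, 1:] ^ n) = [:0, 1:] ^ n + [:1, 1:] ^ n + [:-1, 1:] ^ n"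
    unfolding UNIV_of_CARD_3(1)[OF q] using UNIV_of_CARD_3(2)[OF q] by (simp add: add.assoc)
  have eq: "(\<Sum>a\<in>(UNIV :: 'q set). [:a, 1:] ^ n) =
      map_poly prime_field_embed g \<circ>\<^sub>p (monom 1 CARD('q) - monom 1 1)"
    using arg_cong[OF g, of "map_poly (prime_field_embed :: _ \<Rightarrow> 'q)"]
    by (simp add: sum q hom_distribs)
  have "g_poly TYPE('q) n = g"
    unfolding g_poly_def
  proof (rule the_equality, rule eq)
    fix g' :: "'p mod_ring poly"
    assume "(\<Sum>a\<in>(UNIV :: 'q set). [:a, 1:] ^ n) =
      map_poly prime_field_embed g' \<circ>\<^sub>p (monom 1 CARD('q) - monom 1 1)"
    hence "(map_poly prime_field_embed g' - map_poly prime_field_embed g)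
        \<circ>\<^sub>p (x3_minus_x :: 'q poly) = 0"
      using eq q by (simp add: pcompose_diff)
    hence "map_poly (prime_field_embed :: _ \<Rightarrow> 'q) g' = map_poly prime_field_embed g"
      using pcompose_eq_0[of _ "x3_minus_x :: 'q poly"] degree_x3_minus_x[where ?'k = 'q]
      by (metis right_minus_eq zero_less_numeral)
    thus "g' = g" by simp
  qed
  moreover have "poly (map_poly prime_field_embed g) (x ^ 3 - x) = x ^ n + (x + 1) ^ n + (x - 1) ^ n"
    using arg_cong[OF arg_cong[OF g, of "map_poly (prime_field_embed :: _ \<Rightarrow> 'k)"], of "\<lambda>f. poly f x"]
    by (simp add: hom_distribs poly_pcompose poly_monom add.commute)
  ultimately show ?thesis by simp
qed

section \<open>The trace\<close>

text \<open>This is the absolute trace on a field with \<open>3 ^ e\<close> elements. Stating it for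
  every field allows its use in the algebraic closure.\<close>

definition trace3 :: "nat \<Rightarrow> 'k::field \<Rightarrow> 'k" where
  "trace3 e y = (\<Sum>i<e. y ^ (3 ^ i))"

text \<open>It serves twice: in the finite field the right-hand side vanishes, so elements
  \<open>x ^ 3 - x\<close> have trace zero; in the closure it computes how the Frobenius map shifts
  a root \<open>x\<close>.\<close>

lemma trace3_cube_diff:
  assumes "CHAR('k::field) = 3"
  shows "trace3 e (x ^ 3 - x :: 'k) = x ^ (3 ^ e) - x"
proof -
  have "trace3 e (x ^ 3 - x) = (\<Sum>i<e. x ^ (3 ^ Suc i) - x ^ (3 ^ i))"
    by (simp add: trace3_def CHAR3_frobenius_diff[OF assms] flip: power_mult)
  also have "\<dots> = x ^ (3 ^ e) - x"
    using sum_lessThan_telescope[of "\<lambda>i. x ^ (3 ^ i)" e] by simp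
  finally show ?thesis .
qed

lemma trace3_add:
  assumes "CHAR('k::field) = 3"
  shows "trace3 e (x + y :: 'k) = trace3 e x + trace3 e y"
  by (simp add: trace3_def CHAR3_frobenius_add[OF assms] sum.distrib)

lemma trace3_minus: "trace3 e (- y :: 'k::field) = - trace3 e y"
  by (simp add: trace3_def sum_negf)

lemma trace3_frobenius:
  assumes "CHAR('k::field) = 3" "(y::'k) ^ (3 ^ e) = y"
  shows "trace3 e (y ^ (3 ^ k)) = trace3 e y"
proof (induction k)
  case (Suc k)
  let ?z = "y ^ (3 ^ k)"
  have "?z ^ (3 ^ e) = ?z"
    using assms(2) by (metis mult.commute power_mult)
  hence "trace3 e (?z ^ 3 - ?z) = 0"
    by (simp add: trace3_cube_diff[OF assms(1)])
  hence "trace3 e (?z ^ 3) = trace3 e ?z"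
    using trace3_add[OF assms(1), of e "?z ^ 3 - ?z" ?z] by simp
  thus ?case using Suc by (simp add: mult.commute flip: power_mult)
qed simp

lemma trace3_cube:
  assumes "CHAR('k::field) = 3" "(y::'k) ^ (3 ^ e) = y"
  shows "trace3 e y ^ 3 = trace3 e y"
proof -
  have "trace3 e y ^ 3 = (\<Sum>i<e. (y ^ (3 ^ i)) ^ 3)"
    unfolding trace3_def by (rule freshmans_dream_sum) (use assms in auto)
  also have "\<dots> = trace3 e (y ^ (3 ^ 1))"
    by (simp add: trace3_def mult.commute flip: power_mult)
  also have "\<dots> = trace3 e y" by (rule trace3_frobenius[OF assms])
  finally show ?thesis .
qed

lemma to_ac_trace3: "to_ac (trace3 e y) = trace3 e (to_ac y)"
  by (simp add: trace3_def to_ac_sum)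

section \<open>The power sum\<close>

text \<open>With \<open>m = 3 ^ (e - 2)\<close> this is the given \<open>n\<close>: the powers with
  exponents \<open>e - 1\<close>, \<open>e\<close>, \<open>2 * e - 2\<close> and
  \<open>2 * e\<close> are \<open>3 * m\<close>, \<open>9 * m\<close>, \<open>9 * m ^ 2\<close> and
  \<open>81 * m ^ 2\<close>.\<close>

definition theorem3p6_exponent :: "nat \<Rightarrow> nat" where
  "theorem3p6_exponent m = (4 * m - 1) * (1 + 9 * m + 81 * m\<^sup>2) + 2 + m + 9 * m\<^sup>2"

text \<open>Raising to the power \<open>9 * m\<close> is a Frobenius map that shifts
  \<open>u\<close> by \<open>t\<close> and fixes \<open>t\<close>. Applied twice it gives
  \<open>u + 2 * t = u - t\<close>, so the factor \<open>1 + 9 * m + 81 * m ^ 2\<close> of the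
  exponent produces \<open>u * (u + t) * (u - t)\<close>.\<close>

lemma CHAR3_power_exponent:
  fixes u t :: "'k::field"
  assumes char: "CHAR('k) = 3" and m: "m = 3 ^ d"
    and t: "t ^ 3 = t" and u: "u ^ (9 * m) = u + t"
  shows "u ^ theorem3p6_exponent m
    = (u ^ 3 - t\<^sup>2 * u) ^ (4 * m - 1) * u\<^sup>2 * (u ^ m * (u ^ m + t))"
proof -
  have m9: "9 * m = 3 ^ (d + 2)" by (simp add: m)
  have tp: "t ^ (3 ^ k) = t" for k
    using t by (induction k) (simp_all add: power_mult)
  have "u ^ (81 * m\<^sup>2) = (u ^ (9 * m)) ^ (9 * m)"
    by (simp add: power2_eq_square flip: power_mult)
  also have "\<dots> = u + t + t"
    unfolding u using CHAR3_frobenius_add[OF char, of u t "d + 2"] u tp[of "d + 2"]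
    by (simp only: m9)
  also have "\<dots> = u - t + 3 * t" by (simp add: algebra_simps)
  finally have u81: "u ^ (81 * m\<^sup>2) = u - t" using CHAR3_three_eq_0[OF char] by simp
  have "u ^ (9 * m\<^sup>2) = (u ^ (9 * m)) ^ m"
    by (simp add: power2_eq_square mult.assoc flip: power_mult)
  also have "\<dots> = u ^ m + t"
    using CHAR3_frobenius_add[OF char, of u t d] tp[of d] by (simp only: u m[symmetric])
  finally have u9: "u ^ (9 * m\<^sup>2) = u ^ m + t" .
  have "u ^ (1 + 9 * m + 81 * m\<^sup>2) = u * (u + t) * (u - t)"
    by (simp only: power_add u u81 power_one_right)
  also have "\<dots> = u ^ 3 - t\<^sup>2 * u"
    by (simp add: algebra_simps power2_eq_square power3_eq_cube)
  finally have norm: "u ^ (1 + 9 * m + 81 * m\<^sup>2) = u ^ 3 - t\<^sup>2 * u" .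
  have "u ^ theorem3p6_exponent m
      = (u ^ (1 + 9 * m + 81 * m\<^sup>2)) ^ (4 * m - 1) * u\<^sup>2 * u ^ m * u ^ (9 * m\<^sup>2)"
    unfolding theorem3p6_exponent_def power_add[of u _ "9 * m\<^sup>2"] power_add[of u _ m] power_add[of u _ 2]
    by (simp only: mult.commute[of "4 * m - 1"] power_mult)
  thus ?thesis by (simp only: norm u9 mult.assoc)
qed

text \<open>The elements \<open>x\<close>, \<open>x + 1\<close>, \<open>x - 1\<close> are all
  shifted by the same \<open>t\<close>, so the preceding formula applies to each. If
  \<open>t\<close> is nonzero, then \<open>t ^ 2 = 1\<close> and the large power has the common base
  \<open>x ^ 3 - x\<close>, leaving a sum of low degree.\<close>

lemma CHAR3_power_sum_eval:
  fixes x t :: "'k::field"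
  assumes char: "CHAR('k) = 3" and m: "m = 3 ^ d"
    and t: "t ^ 3 = t" and x: "x ^ (9 * m) = x + t"
    and v: "v = (x ^ 3 - x) ^ m" and v0: "t \<noteq> 0 \<Longrightarrow> v \<noteq> 0"
  shows "x ^ theorem3p6_exponent m + (x + 1) ^ theorem3p6_exponent m
      + (x - 1) ^ theorem3p6_exponent m
    = (if t = 0 then - v else - v - (inverse v ^ 3 - inverse v))"
proof -
  let ?n = "theorem3p6_exponent m"
  have three: "(3::'k) = 0" by (rule CHAR3_three_eq_0[OF char])
  define w where "w = x ^ m"
  have m1: "(1::'k) ^ m = 1" by simp
  have vw: "v = w ^ 3 - w"
    unfolding v w_def m CHAR3_frobenius_diff[OF char] by (simp add: mult.commute flip: power_mult)
  have wpm: "(x + 1) ^ m = w + 1" "(x - 1) ^ m = w - 1"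
    by (simp_all add: w_def m CHAR3_frobenius_add[OF char] CHAR3_frobenius_diff[OF char])
  have m9: "9 * m = 3 ^ (d + 2)" by (simp add: m)
  have xpm: "(x + 1) ^ (9 * m) = (x + 1) + t" "(x - 1) ^ (9 * m) = (x - 1) + t"
    using x unfolding m9 CHAR3_frobenius_add[OF char] CHAR3_frobenius_diff[OF char]
    by (simp_all add: algebra_simps)
  note pw = CHAR3_power_exponent[OF char m t]
  have "m > 0" by (simp add: m)
  show ?thesis
  proof (cases "t = 0")
    case True
    \<comment> \<open>For \<open>t = 0\<close> the exponent acts as
      \<open>3 * (4 * m - 1) + 2 + 2 * m = 14 * m - 1\<close>. As \<open>u = z ^ 9\<close> with
      \<open>z = u ^ m\<close>, this is \<open>z ^ 14 / z ^ 9\<close>; the extra factor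
      \<open>u\<close> avoids the subtraction.\<close>
    have "u ^ ?n = (u ^ m) ^ 5" if u: "u ^ (9 * m) = u" for u :: 'k
    proof (cases "u = 0")
      case True
      thus ?thesis using \<open>m > 0\<close> by (simp add: theorem3p6_exponent_def)
    next
      case False
      define z where "z = u ^ m"
      have z9: "z ^ 9 = u" using u by (simp add: z_def mult.commute flip: power_mult)
      have "u * u ^ ?n = u ^ 3 * (u ^ 3) ^ (4 * m - 1) * z\<^sup>2"
        using pw[of u] u \<open>t = 0\<close>
        by (simp add: z_def power2_eq_square power3_eq_cube mult_ac)
      also have "u ^ 3 * (u ^ 3) ^ (4 * m - 1) = (u ^ 3) ^ (4 * m)"
        using \<open>m > 0\<close> by (simp flip: power_Suc)
      also have "\<dots> = z ^ 12"
        by (simp add: z_def mult_ac flip: power_mult)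
      also have "z ^ 12 * z\<^sup>2 = z ^ 9 * z ^ 5"
        by (simp flip: power_add)
      finally have "u * u ^ ?n = u * z ^ 5" by (simp only: z9)
      thus ?thesis using False by (simp add: z_def)
    qed
    hence "x ^ ?n + (x + 1) ^ ?n + (x - 1) ^ ?n = w ^ 5 + (w + 1) ^ 5 + (w - 1) ^ 5"
      using x xpm True by (simp add: wpm w_def[symmetric])
    \<comment> \<open>An identity over the integers, with a multiple of 3 split off that vanishes
      here.\<close>
    also have "\<dots> = - (w ^ 3 - w) + 3 * (w ^ 5 + 7 * w ^ 3 + 3 * w)"
      by (simp add: algebra_simps eval_nat_numeral)
    finally show ?thesis using three True by (simp add: vw)
  next
    case False
    hence t2: "t\<^sup>2 = 1" using CHAR3_cube_eq_self[OF t] by auto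
    define y where "y = x ^ 3 - x"
    define c where "c = y ^ (4 * m - 1)"
    have "(x + 1) ^ 3 - (x + 1) = y + 3 * (x\<^sup>2 + x)" "(x - 1) ^ 3 - (x - 1) = y + 3 * (x - x\<^sup>2)"
      by (simp_all add: y_def algebra_simps power2_eq_square power3_eq_cube)
    hence yy: "(x + 1) ^ 3 - (x + 1) = y" "(x - 1) ^ 3 - (x - 1) = y" using three by auto
    have wt: "w ^ 9 = x + t" using x by (simp add: w_def mult.commute flip: power_mult)
    have v3: "v ^ 3 = w ^ 9 - w ^ 3"
      unfolding vw using CHAR3_frobenius_diff[OF char, of "w ^ 3" w 1] by (simp flip: power_mult)
    have v9: "v ^ 9 = y"
    proof -
      have "v ^ 9 = w ^ 27 - w ^ 9"
        unfolding vw using CHAR3_frobenius_diff[OF char, of "w ^ 3" w 2] by (simp flip: power_mult)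
      also have "w ^ 27 = (w ^ 9) ^ 3" by (simp flip: power_mult)
      also have "\<dots> = x ^ 3 + t"
        unfolding wt using CHAR3_frobenius_add[OF char, of x t 1] t by simp
      finally show ?thesis by (simp add: wt y_def)
    qed
    \<comment> \<open>Since \<open>y = v ^ 9\<close> and \<open>y ^ m = v\<close>, the common factor
      \<open>c = y ^ (4 * m) / y\<close> is \<open>v ^ 4 / v ^ 9\<close>.\<close>
    have "y * c = y ^ (4 * m)"
      using \<open>m > 0\<close> by (simp add: c_def flip: power_Suc)
    also have "\<dots> = v ^ 4" by (simp add: v y_def mult.commute flip: power_mult)
    finally have "v ^ 9 * c = v ^ 4" by (simp only: v9)
    hence "v ^ 4 * (v ^ 5 * c) = v ^ 4 * 1" by (simp flip: power_add mult.assoc)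
    hence cv: "v ^ 5 * c = 1" using v0[OF False] by (subst (asm) mult_left_cancel) auto
    have "x ^ ?n + (x + 1) ^ ?n + (x - 1) ^ ?n
       = c * (x\<^sup>2 * (w * (w + t)) + (x + 1)\<^sup>2 * ((w + 1) * (w + 1 + t))
          + (x - 1)\<^sup>2 * ((w - 1) * (w - 1 + t)))"
      unfolding pw[OF x] pw[OF xpm(1)] pw[OF xpm(2)] wpm w_def[symmetric] t2 mult_1 yy
        y_def[symmetric] c_def[symmetric]
      by (simp only: distrib_left mult.assoc)
    \<comment> \<open>Modulo 3 and \<open>t ^ 2 = 1\<close> the bracket is minus a square. Its base
      is \<open>w ^ 9 - w\<close>, because \<open>w ^ 9 = x + t\<close>, and splits as
      \<open>(w ^ 9 - w ^ 3) + (w ^ 3 - w)\<close>.\<close>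
    also have "x\<^sup>2 * (w * (w + t)) + (x + 1)\<^sup>2 * ((w + 1) * (w + 1 + t))
          + (x - 1)\<^sup>2 * ((w - 1) * (w - 1 + t))
       = - (x + t - w)\<^sup>2 + (t\<^sup>2 - 1)
          + 3 * (x\<^sup>2 * w\<^sup>2 + x\<^sup>2 * w * t + x\<^sup>2 + w\<^sup>2 + 2 * x * w + 2 * x * t + 1)"
      by (simp add: algebra_simps power2_eq_square)
    also have "\<dots> = - (w ^ 9 - w)\<^sup>2" using three t2 by (simp add: wt)
    also have "w ^ 9 - w = v ^ 3 + v" by (simp only: v3) (simp add: vw)
    finally have S: "x ^ ?n + (x + 1) ^ ?n + (x - 1) ^ ?n = - (c * (v ^ 3 + v)\<^sup>2)" by simp
    have ci: "c = inverse v ^ 5"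
      using cv v0[OF False] by (simp add: field_simps)
    have "c * (v ^ 3 + v)\<^sup>2 = v + (inverse v ^ 3 - inverse v) + 3 * inverse v"
      unfolding ci using v0[OF False] by (simp add: field_simps eval_nat_numeral)
    thus ?thesis using S False three by (simp add: algebra_simps)
  qed
qed

section \<open>Injectivity\<close>

text \<open>The collision gives \<open>D = \<delta> ^ 3 - \<delta>\<close> for the difference
  \<open>D\<close> of the two elements, while \<open>D = \<delta> * p\<close> for their product
  \<open>p\<close>; hence \<open>p = \<delta> ^ 2 - 1\<close>. It remains to treat
  \<open>v - D\<close>, which is \<open>- (v + v')\<close> in characteristic three, so its square is
  \<open>D ^ 2 + 4 * p\<close> and becomes a function of \<open>p\<close> alone.\<close>

lemma CHAR3_collision:
  fixes v v' :: "'k::field"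
  assumes char: "CHAR('k) = 3" and nz: "v \<noteq> 0" "v' \<noteq> 0" and "v \<noteq> v'"
    and eq: "v + (inverse v ^ 3 - inverse v) = v' + (inverse v' ^ 3 - inverse v')"
  shows "\<exists>r. v = r ^ 3 - r"
proof -
  have three: "(3::'k) = 0" by (rule CHAR3_three_eq_0[OF char])
  have cube_add: "(a + b) ^ 3 = a ^ 3 + b ^ 3" for a b :: 'k
    using CHAR3_frobenius_add[OF char, of a b 1] by simp
  have cube_diff: "(a - b) ^ 3 = a ^ 3 - b ^ 3" for a b :: 'k
    using CHAR3_frobenius_diff[OF char, of a b 1] by simp
  define \<delta> where "\<delta> = inverse v - inverse v'"
  define p where "p = v * v'"
  define D where "D = v' - v"
  have "\<delta> \<noteq> 0" using \<open>v \<noteq> v'\<close> by (simp add: \<delta>_def)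
  have D\<delta>: "D = \<delta> * p" using nz by (simp add: D_def \<delta>_def p_def field_simps)
  have "D = \<delta> ^ 3 - \<delta>"
    using eq unfolding D_def \<delta>_def cube_diff by (simp add: algebra_simps)
  hence "\<delta> * p = \<delta> * (\<delta>\<^sup>2 - 1)"
    using D\<delta> by (simp add: algebra_simps power2_eq_square power3_eq_cube)
  hence p: "p = \<delta>\<^sup>2 - 1" using \<open>\<delta> \<noteq> 0\<close> by simp
  have "(v - D)\<^sup>2 = p + D\<^sup>2 - 3 * (v * D)"
    by (simp add: p_def D_def algebra_simps power2_eq_square)
  also have "D\<^sup>2 = (p + 1) * p\<^sup>2"
    by (simp add: D\<delta> p power_mult_distrib)
  also have "p + (p + 1) * p\<^sup>2 - 3 * (v * D) = p * (p - 1)\<^sup>2 + 3 * (p\<^sup>2 - v * D)"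
    by (simp add: algebra_simps power2_eq_square)
  finally have sq: "(v - D)\<^sup>2 = p * (p - 1)\<^sup>2" using three by simp
  have "\<exists>r. v - D = r ^ 3 - r"
  proof (cases "p = 1")
    case True
    thus ?thesis using sq by (intro exI[of _ 0]) simp
  next
    case False
    \<comment> \<open>By the formula for the square, this quotient is a square root of
      \<open>p\<close>, so \<open>r * (p - 1)\<close> is \<open>r ^ 3 - r\<close>.\<close>
    define r where "r = (v - D) / (p - 1)"
    have "r\<^sup>2 = p" using False by (simp add: r_def power_divide sq)
    moreover have "v - D = r * (p - 1)" using False by (simp add: r_def)
    ultimately have "v - D = r ^ 3 - r"
      by (simp add: algebra_simps power2_eq_square power3_eq_cube)
    thus ?thesis ..
  qed
  then obtain r where "v - D = r ^ 3 - r" ..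
  hence "v = (r + \<delta>) ^ 3 - (r + \<delta>)"
    using \<open>D = \<delta> ^ 3 - \<delta>\<close> by (simp add: cube_add algebra_simps)
  thus ?thesis ..
qed

lemma CHAR3_twist_eqD:
  fixes y y' :: "'k::field"
  assumes char: "CHAR('k) = 3" and Q: "\<And>z::'k. z ^ (3 ^ e) = z"
    and F: "\<And>v. F v = (if trace3 e v = 0 then - v else - v - (inverse v ^ 3 - inverse v))"
    and eq: "F y = F y'"
  shows "y = y'"
proof -
  have tr0: "trace3 e (s ^ 3 - s) = 0" for s :: 'k
    using Q by (simp add: trace3_cube_diff[OF char])
  have trF: "trace3 e (F v) = - trace3 e v" for v
  proof -
    have "trace3 e (- v - (inverse v ^ 3 - inverse v)) = - trace3 e v"
      unfolding diff_conv_add_uminus[of "- v"] trace3_add[OF char] trace3_minus tr0 by simp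
    thus ?thesis by (simp add: F trace3_minus)
  qed
  \<comment> \<open>Equal values force equal traces, so both arguments fall into the same branch of
    \<open>F\<close>.\<close>
  have tr: "trace3 e y = trace3 e y'"
    using trF[of y] trF[of y'] eq by simp
  show ?thesis
  proof (cases "trace3 e y = 0")
    case True
    thus ?thesis using eq tr by (simp add: F)
  next
    case False
    have "trace3 e (0::'k) = 0" using tr0[of 0] by simp
    hence "y \<noteq> 0" "y' \<noteq> 0" using False tr by auto
    moreover have "y + (inverse y ^ 3 - inverse y) = y' + (inverse y' ^ 3 - inverse y')"
      using eq False tr by (simp add: F algebra_simps)
    ultimately show ?thesis
      using CHAR3_collision[OF char, of y y'] tr0 False by auto
  qed
qed

text \<open>If \<open>y\<close> has nonzero trace, no such \<open>x\<close> exists in the finite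
  field itself; this is why values of \<open>g\<close> are computed in the closure.\<close>

lemma alg_closed_cube_diff_surj:
  fixes y :: "'k::alg_closed_field"
  shows "\<exists>x. x ^ 3 - x = y"
proof -
  have "\<exists>x. poly [:-y, -1, 0, 1:] x = 0"
    by (rule alg_closed_imp_poly_has_root) simp
  thus ?thesis by (auto simp: algebra_simps power3_eq_cube)
qed

section \<open>Descent from the algebraic closure and conclusion\<close>

theorem theorem3p6:
  fixes e n :: nat
    and g :: "'p::prime_card mod_ring poly"
  assumes "CARD('p) = 3"
    and "CARD('q::{field,finite}) = 3"
    and "CARD('a::{field,finite}) = 3 ^ e"
    and "e \<ge> 3"
    and "n = (3 ^ (e - 1) + 3 ^ (e - 2) - 1) * (1 + 3 ^ e + 3 ^ (2 * e))
             + 2 + 3 ^ (e - 2) + 3 ^ (2 * e - 2)"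
    and "g = g_poly TYPE('q) n"
  shows "permutation_poly (map_poly prime_field_embed g :: 'a poly)"
proof -
  define d where "d = e - 2"
  hence d: "e = d + 2" using \<open>e \<ge> 3\<close> by simp
  define m :: nat where "m = 3 ^ d"
  have "(9::nat) ^ d = 3 ^ d * 3 ^ d" by (simp flip: power_mult_distrib)
  hence n: "n = theorem3p6_exponent m"
    unfolding assms(5) theorem3p6_exponent_def m_def d
    by (simp add: power_add power_mult power2_eq_square)
  have char: "CHAR('a) = 3"
    using assms(3) by (rule CHAR_eq_of_CARD_power) simp
  hence charK: "CHAR('a alg_closure) = 3" by simp
  have Q: "z ^ (3 ^ e) = z" for z :: 'a
    using finite_field_power_CARD[of z] assms(3) by simp
  let ?G = "map_poly prime_field_embed g :: 'a poly"
  define F where "F v = (if trace3 e v = 0 then - v else - v - (inverse v ^ 3 - inverse v))" for v :: 'a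
  have G: "poly ?G y = F (y ^ m)" for y
  proof -
    interpret ac: inj_comm_ring_hom "to_ac :: 'a \<Rightarrow> 'a alg_closure"
      by unfold_locales auto
    obtain x where x: "x ^ 3 - x = to_ac y" using alg_closed_cube_diff_surj by blast
    define t where "t = trace3 e y"
    have t3: "t ^ 3 = t" unfolding t_def by (rule trace3_cube[OF char Q])
    have "to_ac t = x ^ (3 ^ e) - x"
      unfolding t_def to_ac_trace3 x[symmetric] by (rule trace3_cube_diff[OF charK])
    hence xt: "x ^ (9 * m) = x + to_ac t" by (simp add: d m_def power_add mult.commute)
    \<comment> \<open>\<open>F\<close> branches on the trace of \<open>y ^ m\<close>, the power sum
      on that of \<open>y\<close>; the two are Frobenius conjugates, so the cases match.\<close>
    have trv: "trace3 e (y ^ m) = t"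
      unfolding t_def m_def by (rule trace3_frobenius[OF char Q])
    have nz: "y ^ m \<noteq> 0" if "t \<noteq> 0"
    proof
      assume "y ^ m = 0"
      hence "trace3 e (0::'a) = t" using trv by (simp only:)
      thus False using that by (simp add: trace3_def power_0_left)
    qed
    \<comment> \<open>Both embeddings of the prime field are given by \<open>of_int\<close>, with
      which \<open>to_ac\<close> commutes.\<close>
    have "map_poly to_ac ?G = map_poly prime_field_embed g"
      by (simp add: map_poly_map_poly o_def prime_field_embed_def[abs_def])
    hence "to_ac (poly ?G y) = poly (map_poly prime_field_embed g) (x ^ 3 - x)"
      unfolding x using ac.poly_map_poly[of ?G y] by simp
    also have "\<dots> = x ^ n + (x + 1) ^ n + (x - 1) ^ n"
      unfolding assms(6) by (rule poly_g_poly[OF assms(1,2) charK])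
    also have "\<dots> = (if to_ac t = 0 then - to_ac (y ^ m)
        else - to_ac (y ^ m) - (inverse (to_ac (y ^ m)) ^ 3 - inverse (to_ac (y ^ m))))"
      unfolding n
      by (rule CHAR3_power_sum_eval[OF charK m_def _ xt])
         (use t3 nz in \<open>simp_all add: x flip: to_ac_power\<close>)
    also have "\<dots> = to_ac (F (y ^ m))"
      by (simp add: F_def trv)
    finally show ?thesis by simp
  qed
  have "inj (poly ?G)"
  proof (rule injI)
    fix y y' assume "poly ?G y = poly ?G y'"
    hence "y ^ m = y' ^ m"
      unfolding G by (rule CHAR3_twist_eqD[OF char Q F_def])
    \<comment> \<open>Since \<open>9 * m = 3 ^ e\<close>, the ninth power undoes
      \<open>y ^ m\<close>.\<close>
    hence "(y ^ m) ^ 9 = (y' ^ m) ^ 9" by simp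
    thus "y = y'" using Q[of y] Q[of y']
      by (simp add: m_def d power_add mult.commute flip: power_mult)
  qed
  thus ?thesis
    unfolding permutation_poly_def bij_def using finite_UNIV_inj_surj[OF finite] by simp
qed

end
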